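(* Let $\mathrm{pr}_1 \colon B \times F \to B$ be the projection map. Then $$\mathrm{TC}^{\Sigma}[\mathrm{pr}_1 \colon B \times F \to B] = \mathrm{TC}^{\Sigma}(F).$$
   Context: Let $I=[0,1]$ and $G = \mathbb{Z}_2 = \langle g\rangle$. The equivariant sectional category $\mathrm{secat}_G(q)$ of a $G$-map $q \colon X \to Y$ is the least nonnegative integer $k$ such that $Y$ has a cover by $G$-invariant open sets $U_0,\dots,U_k$ with $G$-maps $s_i \colon U_i \to X$ such that $q\circ s_i$ is $G$-homotopic to the inclusion $U_i \hookrightarrow Y$ ($\infty$ if none exists). For a (Hurewicz) fibration $p \colon E \to B$: $E \times_B E = \{(e_1,e_2)\in E\times E \mid p(e_1)=p(e_2)\}$ with $g\cdot(e_1,e_2)=(e_2,e_1)$; $E^I_B = \{\gamma \in E^I \mid p\circ\gamma \text{ is constant}\}$ (subspace of $E^I$ with compact-open topology) with $(g\cdot\gamma)(t)=\gamma(1-t)$; $\Pi \colon E^I_B \to E \times_B E$, $\Pi(\gamma)=(\gamma(0),\gamma(1))$, is a $G$-fibration. The symmetrized parametrized topological complexity is $\mathrm{TC}^{\Sigma}[p \colon E\to B] := \mathrm{secat}_G(\Pi)$. For a space $X$, the symmetrized topological complexity is $\mathrm{TC}^{\Sigma}(X) := \mathrm{secat}_G(\pi)$, where $\pi \colon X^I \to X\times X$, $\pi(\gamma) = (\gamma(0),\gamma(1))$, with $G$ acting by path reversal on $X^I$ and by transposition on $X \times X$. *)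

theory Defs
  imports "HOL-Analysis.Analysis"
begin

section \<open>Spaces and maps with an action of the group of order two\<close>

text \<open>An action of the group of order two on a space \<open>X\<close> is given by the action \<open>\<sigma>\<close> of its
  generator, a continuous involution of \<open>X\<close>.\<close>

definition Z2_space :: "'a topology \<Rightarrow> ('a \<Rightarrow> 'a) \<Rightarrow> bool" where
  "Z2_space X \<sigma> \<longleftrightarrow> continuous_map X X \<sigma> \<and> (\<forall>x\<in>topspace X. \<sigma> (\<sigma> x) = x)"

definition Z2_map ::
  "'a topology \<Rightarrow> ('a \<Rightarrow> 'a) \<Rightarrow> 'b topology \<Rightarrow> ('b \<Rightarrow> 'b) \<Rightarrow> ('a \<Rightarrow> 'b) \<Rightarrow> bool" where
  "Z2_map X \<sigma> Y \<tau> f \<longleftrightarrow> continuous_map X Y f \<and> (\<forall>x\<in>topspace X. f (\<sigma> x) = \<tau> (f x))"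

text \<open>The group acts trivially on the interval parametrizing a homotopy, so a homotopy is
  equivariant iff each of its stages is.\<close>

definition Z2_homotopic ::
  "'a topology \<Rightarrow> ('a \<Rightarrow> 'a) \<Rightarrow> 'b topology \<Rightarrow> ('b \<Rightarrow> 'b) \<Rightarrow> ('a \<Rightarrow> 'b) \<Rightarrow> ('a \<Rightarrow> 'b) \<Rightarrow> bool" where
  "Z2_homotopic X \<sigma> Y \<tau> = homotopic_with (Z2_map X \<sigma> Y \<tau>) X Y"

definition secat_Z2_le ::
  "'a topology \<Rightarrow> ('a \<Rightarrow> 'a) \<Rightarrow> 'b topology \<Rightarrow> ('b \<Rightarrow> 'b) \<Rightarrow> ('a \<Rightarrow> 'b) \<Rightarrow> nat \<Rightarrow> bool" where
  "secat_Z2_le X \<sigma> Y \<tau> q k \<longleftrightarrow>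
     (\<exists>U s. topspace Y = (\<Union>i\<le>k. U i) \<and>
        (\<forall>i\<le>k. openin Y (U i) \<and> \<tau> ` U i \<subseteq> U i \<and>
           Z2_map (subtopology Y (U i)) \<tau> X \<sigma> (s i) \<and>
           Z2_homotopic (subtopology Y (U i)) \<tau> Y \<tau> (q \<circ> s i) id))"

text \<open>The infimum of the empty set is \<open>\<infinity>\<close>.\<close>

definition secat_Z2 ::
  "'a topology \<Rightarrow> ('a \<Rightarrow> 'a) \<Rightarrow> 'b topology \<Rightarrow> ('b \<Rightarrow> 'b) \<Rightarrow> ('a \<Rightarrow> 'b) \<Rightarrow> enat" where
  "secat_Z2 X \<sigma> Y \<tau> q = Inf {enat k | k. secat_Z2_le X \<sigma> Y \<tau> q k}"


section \<open>Path spaces\<close>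

text \<open>The points of the mapping space are extensional functions, so that each continuous map on
  \<open>topspace X\<close> is represented exactly once. Taking \<open>K = {}\<close> shows that every such function
  belongs to the generated topology's carrier.\<close>

definition compact_open_topology :: "'a topology \<Rightarrow> 'b topology \<Rightarrow> ('a \<Rightarrow> 'b) topology" where
  "compact_open_topology X Y = topology_generated_by
     {{f \<in> extensional (topspace X). continuous_map X Y f \<and> f ` K \<subseteq> U} | K U.
        compactin X K \<and> openin Y U}"

lemma topspace_compact_open_topology:
  "topspace (compact_open_topology X Y) = {f \<in> extensional (topspace X). continuous_map X Y f}"
proof -
  have "{f \<in> extensional (topspace X). continuous_map X Y f \<and> f ` {} \<subseteq> {}}
        \<subseteq> topspace (compact_open_topology X Y)"
    unfolding compact_open_topology_def topology_generated_by_topspace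
    by (rule Union_upper) (use compactin_empty openin_empty in blast)
  then show ?thesis
    by (auto simp: compact_open_topology_def)
qed

definition path_space :: "'a topology \<Rightarrow> (real \<Rightarrow> 'a) topology" where
  "path_space X = compact_open_topology (top_of_set {0..1}) X"

definition reverse_path :: "(real \<Rightarrow> 'a) \<Rightarrow> real \<Rightarrow> 'a" where
  "reverse_path \<gamma> = (\<lambda>t\<in>{0..1}. \<gamma> (1 - t))"

definition endpoints :: "(real \<Rightarrow> 'a) \<Rightarrow> 'a \<times> 'a" where
  "endpoints \<gamma> = (\<gamma> 0, \<gamma> 1)"


section \<open>Symmetrized topological complexity\<close>

definition symm_TC :: "'a topology \<Rightarrow> enat" where
  "symm_TC X = secat_Z2 (path_space X) reverse_path (prod_topology X X) prod.swap endpoints"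

definition fibre_square :: "'e topology \<Rightarrow> ('e \<Rightarrow> 'b) \<Rightarrow> ('e \<times> 'e) topology" where
  "fibre_square E p = subtopology (prod_topology E E) {(e1, e2). p e1 = p e2}"

definition fibrewise_path_space ::
  "'e topology \<Rightarrow> 'b topology \<Rightarrow> ('e \<Rightarrow> 'b) \<Rightarrow> (real \<Rightarrow> 'e) topology" where
  "fibrewise_path_space E B p =
     subtopology (path_space E) {\<gamma>. \<exists>b\<in>topspace B. \<forall>t\<in>{0..1}. p (\<gamma> t) = b}"

text \<open>This is meant for a fibration \<open>p\<close> from \<open>E\<close> to \<open>B\<close>, but the formula makes sense for every
  continuous map. The topology of \<open>B\<close> enters only through its set of points.\<close>

definition symm_param_TC :: "'e topology \<Rightarrow> 'b topology \<Rightarrow> ('e \<Rightarrow> 'b) \<Rightarrow> enat" where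
  "symm_param_TC E B p =
     secat_Z2 (fibrewise_path_space E B p) reverse_path (fibre_square E p) prod.swap endpoints"


section \<open>The maps above are maps of spaces with involution\<close>

lemma topspace_path_space:
  "topspace (path_space X) = {\<gamma> \<in> extensional {0..1}. pathin X \<gamma>}"
  by (simp add: path_space_def topspace_compact_open_topology pathin_def)

lemma reverse_path_in_path_space:
  assumes "\<gamma> \<in> topspace (path_space X)"
  shows "reverse_path \<gamma> \<in> topspace (path_space X)"
proof -
  have "continuous_map (top_of_set {0..1}) (top_of_set {0..1}) (\<lambda>t::real. 1 - t)"
    by (auto intro!: continuous_intros)
  moreover have "continuous_map (top_of_set {0..1}) X \<gamma>"
    using assms by (simp add: topspace_path_space pathin_def)
  ultimately have "continuous_map (top_of_set {0..1}) X (\<gamma> \<circ> (\<lambda>t. 1 - t))"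
    by (rule continuous_map_compose)
  then have "continuous_map (top_of_set {0..1}) X (reverse_path \<gamma>)"
    by (rule continuous_map_eq) (auto simp: reverse_path_def)
  then show ?thesis
    by (auto simp: topspace_path_space pathin_def reverse_path_def)
qed

lemma reverse_reverse_path:
  "\<gamma> \<in> topspace (path_space X) \<Longrightarrow> reverse_path (reverse_path \<gamma>) = \<gamma>"
  by (auto simp: topspace_path_space reverse_path_def extensional_def)

lemma openin_path_space_subbasis:
  assumes "compact K" "K \<subseteq> {0..1}" "openin X U"
  shows "openin (path_space X) {\<gamma> \<in> topspace (path_space X). \<gamma> ` K \<subseteq> U}"
  unfolding topspace_path_space path_space_def compact_open_topology_def pathin_def
  using assms
  by (intro topology_generated_by_Basis)
     (auto simp: compactin_subtopology conj_assoc intro!: exI[of _ K] exI[of _ U])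

lemma Z2_space_path_space: "Z2_space (path_space X) reverse_path"
proof -
  define S where "S = {{f \<in> extensional (topspace (top_of_set {0..1})).
    continuous_map (top_of_set {0..1}) X f \<and> f ` K \<subseteq> U} | K U.
    compactin (top_of_set {0..1::real}) K \<and> openin X U}"
  have S: "path_space X = topology_generated_by S"
    by (simp add: S_def path_space_def compact_open_topology_def)
  have "continuous_map (path_space X) (topology_generated_by S) reverse_path"
  proof (rule continuous_on_generated_topo)
    fix V assume "V \<in> S"
    then obtain K U where K: "compact K" "K \<subseteq> {0..1}" and U: "openin X U"
      and V: "V = {f \<in> topspace (path_space X). f ` K \<subseteq> U}"
      by (auto simp: S_def compactin_subtopology topspace_path_space pathin_def)
    let ?K = "(\<lambda>t. 1 - t) ` K"
    have "compact ?K" "?K \<subseteq> {0..1}"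
      using K by (auto intro!: compact_continuous_image continuous_intros)
    moreover have "reverse_path \<gamma> ` K = \<gamma> ` ?K" for \<gamma> :: "real \<Rightarrow> 'a"
      unfolding image_image using K(2) by (intro image_cong) (auto simp: reverse_path_def)
    then have "reverse_path -` V \<inter> topspace (path_space X)
        = {\<gamma> \<in> topspace (path_space X). \<gamma> ` ?K \<subseteq> U}"
      using reverse_path_in_path_space unfolding V by auto
    ultimately show "openin (path_space X) (reverse_path -` V \<inter> topspace (path_space X))"
      by (simp add: openin_path_space_subbasis U)
  next
    show "reverse_path ` topspace (path_space X) \<subseteq> \<Union> S"
      using reverse_path_in_path_space [of _ X]
      unfolding S topology_generated_by_topspace by blast
  qed
  then show ?thesis
    unfolding S [symmetric] by (simp add: Z2_space_def reverse_reverse_path)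
qed

lemma continuous_map_eval_path:
  assumes "t \<in> {0..1}"
  shows "continuous_map (path_space X) X (\<lambda>\<gamma>. \<gamma> t)"
  unfolding continuous_map_def
proof (intro conjI allI impI)
  show "(\<lambda>\<gamma>. \<gamma> t) \<in> topspace (path_space X) \<rightarrow> topspace X"
    using assms by (auto simp: topspace_path_space pathin_def continuous_map_def)
next
  fix U assume "openin X U"
  then show "openin (path_space X) {\<gamma> \<in> topspace (path_space X). \<gamma> t \<in> U}"
    using openin_path_space_subbasis [of "{t}" X U] assms by simp
qed

lemma Z2_map_endpoints:
  "Z2_map (path_space X) reverse_path (prod_topology X X) prod.swap endpoints"
proof -
  have "continuous_map (path_space X) (prod_topology X X) (\<lambda>\<gamma>. (\<gamma> 0, \<gamma> 1))"
    by (intro continuous_map_pairedI continuous_map_eval_path) auto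
  then show ?thesis
    by (simp add: Z2_map_def endpoints_def [abs_def] reverse_path_def)
qed

lemma Z2_space_fibrewise_path_space: "Z2_space (fibrewise_path_space E B p) reverse_path"
proof -
  have "reverse_path \<gamma> \<in> {\<gamma>. \<exists>b\<in>topspace B. \<forall>t\<in>{0..1}. p (\<gamma> t) = b}"
    if "\<gamma> \<in> {\<gamma>. \<exists>b\<in>topspace B. \<forall>t\<in>{0..1}. p (\<gamma> t) = b}" for \<gamma>
    using that by (auto simp: reverse_path_def)
  then show ?thesis
    using Z2_space_path_space [of E]
    by (auto simp: Z2_space_def fibrewise_path_space_def continuous_map_in_subtopology
        intro: continuous_map_from_subtopology)
qed

lemma Z2_map_endpoints_fibrewise:
  "Z2_map (fibrewise_path_space E B p) reverse_path (fibre_square E p) prod.swap endpoints"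
  using Z2_map_endpoints [of E]
  by (auto simp: Z2_map_def fibrewise_path_space_def fibre_square_def endpoints_def
      continuous_map_in_subtopology intro: continuous_map_from_subtopology)

lemma Z2_space_prod_swap: "Z2_space (prod_topology X X) prod.swap"
proof -
  have "continuous_map (prod_topology X X) (prod_topology X X) (\<lambda>z. (snd z, fst z))"
    by (intro continuous_map_pairedI continuous_map_fst continuous_map_snd)
  then show ?thesis
    by (simp add: Z2_space_def prod.swap_def [abs_def])
qed

lemma Z2_space_fibre_square: "Z2_space (fibre_square E p) prod.swap"
  using Z2_space_prod_swap [of E]
  by (auto simp: Z2_space_def fibre_square_def continuous_map_in_subtopology
      intro: continuous_map_from_subtopology)

end

theory Submission
  imports Defs
begin

text \<open>The fibre square of \<open>pr\<^sub>1\<close> is \<open>B \<times> (F \<times> F)\<close>, the fibrewise path space is \<open>B \<times> F\<^sup>I\<close>, and \<open>\<Pi>\<close>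
  becomes \<open>id \<times> \<pi>\<close>. Multiplying local sections and homotopies by the identity of \<open>B\<close> gives one
  inequality. For the other one, a point of \<open>B\<close> exhibits \<open>F \<times> F\<close> as an equivariant retract of the
  fibre square, and the retraction is covered by a map of the path spaces.\<close>

section \<open>Equivariant sectional category\<close>

lemma Z2_map_imp_continuous_map: "Z2_map X \<sigma> Y \<tau> f \<Longrightarrow> continuous_map X Y f"
  by (simp add: Z2_map_def)

lemma Z2_map_compose:
  assumes "Z2_map X \<sigma> Y \<tau> f" "Z2_map Y \<tau> Z \<rho> g"
  shows "Z2_map X \<sigma> Z \<rho> (g \<circ> f)"
  unfolding Z2_map_def
proof (intro conjI ballI)
  show "continuous_map X Z (g \<circ> f)"
    using assms by (intro continuous_map_compose[of X Y]) (simp_all add: Z2_map_def)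
  show "(g \<circ> f) (\<sigma> x) = \<rho> ((g \<circ> f) x)" if "x \<in> topspace X" for x
    using assms that continuous_map_image_subset_topspace[of X Y f] by (auto simp: Z2_map_def)
qed

text \<open>Equivariance at \<open>x\<close> also reads the map at \<open>\<sigma> x\<close>, so
  agreement on the carrier suffices because \<open>\<sigma>\<close> preserves the carrier.
  \<open>homotopic_with_eq\<close> requires this insensitivity to values elsewhere.\<close>

lemma Z2_map_cong:
  assumes "Z2_space X \<sigma>" "\<And>x. x \<in> topspace X \<Longrightarrow> f x = g x"
  shows "Z2_map X \<sigma> Y \<tau> f \<longleftrightarrow> Z2_map X \<sigma> Y \<tau> g"
proof -
  have "\<sigma> x \<in> topspace X" if "x \<in> topspace X" for x
    using assms(1) that continuous_map_image_subset_topspace[of X X \<sigma>]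
    by (auto simp: Z2_space_def)
  moreover have "continuous_map X Y f \<longleftrightarrow> continuous_map X Y g"
    using assms(2) by (auto intro: continuous_map_eq[of X Y f g] continuous_map_eq[of X Y g f])
  ultimately show ?thesis
    using assms(2) by (auto simp: Z2_map_def)
qed

lemma Z2_space_subtopology:
  assumes "Z2_space X \<sigma>" "\<sigma> ` S \<subseteq> S"
  shows "Z2_space (subtopology X S) \<sigma>"
  using assms
  by (auto simp: Z2_space_def continuous_map_in_subtopology intro: continuous_map_from_subtopology)

lemma Z2_map_subtopology:
  assumes "Z2_map X \<sigma> Y \<tau> f" "f ` (topspace X \<inter> S) \<subseteq> T"
  shows "Z2_map (subtopology X S) \<sigma> (subtopology Y T) \<tau> f"
  using assms
  by (auto simp: Z2_map_def continuous_map_in_subtopology intro: continuous_map_from_subtopology)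

lemma secat_Z2_leE:
  assumes "secat_Z2_le X \<sigma> Y \<tau> q k"
  obtains U s where "topspace Y = (\<Union>j\<le>k. U j)"
    and "\<And>j. j \<le> k \<Longrightarrow> openin Y (U j)" "\<And>j. j \<le> k \<Longrightarrow> \<tau> ` U j \<subseteq> U j"
    and "\<And>j. j \<le> k \<Longrightarrow> Z2_map (subtopology Y (U j)) \<tau> X \<sigma> (s j)"
    and "\<And>j. j \<le> k \<Longrightarrow> Z2_homotopic (subtopology Y (U j)) \<tau> Y \<tau> (q \<circ> s j) id"
proof -
  from assms obtain U s where "topspace Y = (\<Union>j\<le>k. U j)"
    and "\<forall>j\<le>k. openin Y (U j) \<and> \<tau> ` U j \<subseteq> U j \<and>
      Z2_map (subtopology Y (U j)) \<tau> X \<sigma> (s j) \<and>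
      Z2_homotopic (subtopology Y (U j)) \<tau> Y \<tau> (q \<circ> s j) id"
    unfolding secat_Z2_le_def by (elim exE conjE)
  then show thesis
    by (intro that[of U s]) simp_all
qed

text \<open>Monotonicity under equivariant retracts: over the preimage of \<open>U j\<close> under
  \<open>i\<close>, the section \<open>f \<circ> s j \<circ> i\<close> works, because
  \<open>q' \<circ> f = r \<circ> q\<close> turns the homotopy from \<open>q \<circ> s j\<close> to
  the inclusion into one from its composite with \<open>q'\<close> to
  \<open>r \<circ> i = id\<close>. Both inequalities of the theorem are instances.\<close>

lemma secat_Z2_le_retract:
  assumes Y': "Z2_space Y' \<tau>'"
    and i: "Z2_map Y' \<tau>' Y \<tau> i" and r: "Z2_map Y \<tau> Y' \<tau>' r"
    and ri: "\<And>y. y \<in> topspace Y' \<Longrightarrow> r (i y) = y"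
    and f: "Z2_map X \<sigma> X' \<sigma>' f"
    and qf: "\<And>x. x \<in> topspace X \<Longrightarrow> q' (f x) = r (q x)"
    and le: "secat_Z2_le X \<sigma> Y \<tau> q k"
  shows "secat_Z2_le X' \<sigma>' Y' \<tau>' q' k"
proof -
  obtain U s where cover: "topspace Y = (\<Union>j\<le>k. U j)"
    and U: "\<And>j. j \<le> k \<Longrightarrow> openin Y (U j)" "\<And>j. j \<le> k \<Longrightarrow> \<tau> ` U j \<subseteq> U j"
    and s: "\<And>j. j \<le> k \<Longrightarrow> Z2_map (subtopology Y (U j)) \<tau> X \<sigma> (s j)"
    and hom: "\<And>j. j \<le> k \<Longrightarrow> Z2_homotopic (subtopology Y (U j)) \<tau> Y \<tau> (q \<circ> s j) id"
    using that by (rule secat_Z2_leE[OF le])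
  define V where "V j = {y \<in> topspace Y'. i y \<in> U j}" for j
  have i_top: "i y \<in> topspace Y" if "y \<in> topspace Y'" for y
    using i that continuous_map_image_subset_topspace[of Y' Y i] by (auto simp: Z2_map_def)
  have \<tau>'_top: "\<tau>' y \<in> topspace Y'" if "y \<in> topspace Y'" for y
    using Y' that continuous_map_image_subset_topspace[of Y' Y' \<tau>'] by (auto simp: Z2_space_def)
  have "topspace Y' = (\<Union>j\<le>k. V j)"
    using i_top cover by (auto simp: V_def)
  moreover have "openin Y' (V j) \<and> \<tau>' ` V j \<subseteq> V j \<and>
      Z2_map (subtopology Y' (V j)) \<tau>' X' \<sigma>' (f \<circ> s j \<circ> i) \<and>
      Z2_homotopic (subtopology Y' (V j)) \<tau>' Y' \<tau>' (q' \<circ> (f \<circ> s j \<circ> i)) id" if j: "j \<le> k" for j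
  proof (intro conjI)
    show "openin Y' (V j)"
      unfolding V_def
      by (rule openin_continuous_map_preimage[OF Z2_map_imp_continuous_map[OF i] U(1)[OF j]])
    show V_inv: "\<tau>' ` V j \<subseteq> V j"
      using i U(2)[OF j] \<tau>'_top by (auto simp: V_def Z2_map_def)
    have iV: "Z2_map (subtopology Y' (V j)) \<tau>' (subtopology Y (U j)) \<tau> i"
      by (rule Z2_map_subtopology[OF i]) (auto simp: V_def)
    show "Z2_map (subtopology Y' (V j)) \<tau>' X' \<sigma>' (f \<circ> s j \<circ> i)"
      by (intro Z2_map_compose[OF iV] Z2_map_compose[OF s[OF j]] f)
    \<comment> \<open>The relation \<open>qf\<close> holds on the carrier of \<open>X\<close> only,
      so the values of \<open>s j\<close> must be located there before it applies.\<close>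
    have s_top: "s j y \<in> topspace X" if "y \<in> U j" for y
    proof -
      have "y \<in> topspace (subtopology Y (U j))"
        using that openin_subset[OF U(1)[OF j]] by auto
      then show ?thesis
        using continuous_map_image_subset_topspace[OF Z2_map_imp_continuous_map[OF s[OF j]]]
        by (rule subsetD[OF _ imageI, rotated])
    qed
    \<comment> \<open>The homotopy is first pushed forward along \<open>r\<close>, then pulled back
      along \<open>i\<close>; its ends are afterwards rewritten by \<open>qf\<close> and
      \<open>ri\<close>.\<close>
    have "homotopic_with (Z2_map (subtopology Y (U j)) \<tau> Y' \<tau>') (subtopology Y (U j)) Y'
        (r \<circ> (q \<circ> s j)) (r \<circ> id)"
      using hom[OF j] unfolding Z2_homotopic_def
      by (rule homotopic_with_compose_continuous_map_left)
         (rule Z2_map_imp_continuous_map[OF r], erule Z2_map_compose[OF _ r])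
    then have "homotopic_with (Z2_map (subtopology Y' (V j)) \<tau>' Y' \<tau>') (subtopology Y' (V j)) Y'
        ((r \<circ> (q \<circ> s j)) \<circ> i) ((r \<circ> id) \<circ> i)"
      by (rule homotopic_with_compose_continuous_map_right)
         (rule Z2_map_imp_continuous_map[OF iV], rule Z2_map_compose[OF iV])
    then show "Z2_homotopic (subtopology Y' (V j)) \<tau>' Y' \<tau>' (q' \<circ> (f \<circ> s j \<circ> i)) id"
      unfolding Z2_homotopic_def
    proof (rule homotopic_with_eq)
      show "Z2_map (subtopology Y' (V j)) \<tau>' Y' \<tau>' h \<longleftrightarrow>
          Z2_map (subtopology Y' (V j)) \<tau>' Y' \<tau>' h'"
        if "\<And>x. x \<in> topspace (subtopology Y' (V j)) \<Longrightarrow> h x = h' x" for h h'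
        by (rule Z2_map_cong[OF Z2_space_subtopology[OF Y' V_inv] that])
    qed (auto simp: V_def ri qf s_top)
  qed
  ultimately show ?thesis
    unfolding secat_Z2_le_def
    by (intro exI[of _ V] exI[of _ "\<lambda>j. f \<circ> s j \<circ> i"]) simp
qed

lemma Z2_map_map_prod:
  assumes "Z2_map X \<sigma> Y \<tau> f" "Z2_map X' \<sigma>' Y' \<tau>' f'"
  shows "Z2_map (prod_topology X X') (map_prod \<sigma> \<sigma>') (prod_topology Y Y') (map_prod \<tau> \<tau>')
    (map_prod f f')"
  using assms by (auto simp: Z2_map_def map_prod_def continuous_map_prod_top)

text \<open>With the trivial action on \<open>B\<close>, the whole local data multiply by
  \<open>B\<close>: the open sets become \<open>topspace B \<times> U j\<close>, the sections and
  homotopies acquire an identity factor.\<close>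

lemma secat_Z2_le_prod_id:
  assumes le: "secat_Z2_le X \<sigma> Y \<tau> q k"
  shows "secat_Z2_le (prod_topology B X) (map_prod id \<sigma>) (prod_topology B Y) (map_prod id \<tau>)
    (map_prod id q) k"
proof -
  obtain U s where cover: "topspace Y = (\<Union>j\<le>k. U j)"
    and U: "\<And>j. j \<le> k \<Longrightarrow> openin Y (U j)" "\<And>j. j \<le> k \<Longrightarrow> \<tau> ` U j \<subseteq> U j"
    and s: "\<And>j. j \<le> k \<Longrightarrow> Z2_map (subtopology Y (U j)) \<tau> X \<sigma> (s j)"
    and hom: "\<And>j. j \<le> k \<Longrightarrow> Z2_homotopic (subtopology Y (U j)) \<tau> Y \<tau> (q \<circ> s j) id"
    using that by (rule secat_Z2_leE[OF le])
  have id: "Z2_map B id B id id"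
    by (auto simp: Z2_map_def)
  have "openin (prod_topology B Y) (topspace B \<times> U j) \<and>
      map_prod id \<tau> ` (topspace B \<times> U j) \<subseteq> topspace B \<times> U j \<and>
      Z2_map (subtopology (prod_topology B Y) (topspace B \<times> U j)) (map_prod id \<tau>)
        (prod_topology B X) (map_prod id \<sigma>) (map_prod id (s j)) \<and>
      Z2_homotopic (subtopology (prod_topology B Y) (topspace B \<times> U j)) (map_prod id \<tau>)
        (prod_topology B Y) (map_prod id \<tau>) (map_prod id q \<circ> map_prod id (s j)) id"
    if j: "j \<le> k" for j
    \<comment> \<open>The subspace on \<open>topspace B \<times> U j\<close> becomes a product with
      the subspace on \<open>U j\<close>, so that product maps and product homotopies apply.\<close>
    unfolding prod_topology_subtopology(2)[symmetric]
  proof (intro conjI)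
    show "openin (prod_topology B Y) (topspace B \<times> U j)"
      using U(1)[OF j] by (simp add: openin_prod_Times_iff)
    show "map_prod id \<tau> ` (topspace B \<times> U j) \<subseteq> topspace B \<times> U j"
      using U(2)[OF j] by auto
    show "Z2_map (prod_topology B (subtopology Y (U j))) (map_prod id \<tau>)
        (prod_topology B X) (map_prod id \<sigma>) (map_prod id (s j))"
      by (rule Z2_map_map_prod[OF id s[OF j]])
    \<comment> \<open>The product of the constant homotopy at the identity of \<open>B\<close> with
      the given one; its stages are equivariant by \<open>Z2_map_map_prod\<close>.\<close>
    have "homotopic_with (Z2_map (prod_topology B (subtopology Y (U j))) (map_prod id \<tau>)
        (prod_topology B Y) (map_prod id \<tau>)) (prod_topology B (subtopology Y (U j)))
        (prod_topology B Y) (\<lambda>z. (id (fst z), (q \<circ> s j) (snd z))) (\<lambda>z. (id (fst z), id (snd z)))"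
    proof (rule homotopic_with_prod_topology)
      show "homotopic_with (Z2_map B id B id) B B id id"
        using id by simp
      show "homotopic_with (Z2_map (subtopology Y (U j)) \<tau> Y \<tau>) (subtopology Y (U j)) Y (q \<circ> s j) id"
        using hom[OF j] by (simp add: Z2_homotopic_def)
    qed (unfold map_prod_def[symmetric], rule Z2_map_map_prod)
    then show "Z2_homotopic (prod_topology B (subtopology Y (U j))) (map_prod id \<tau>)
        (prod_topology B Y) (map_prod id \<tau>) (map_prod id q \<circ> map_prod id (s j)) id"
      by (simp add: Z2_homotopic_def map_prod_def o_def case_prod_unfold id_def)
  qed
  moreover have "topspace (prod_topology B Y) = (\<Union>j\<le>k. topspace B \<times> U j)"
    using cover by auto
  ultimately show ?thesis
    unfolding secat_Z2_le_def
    by (intro exI[of _ "\<lambda>j. topspace B \<times> U j"] exI[of _ "\<lambda>j. map_prod id (s j)"]) simp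
qed

section \<open>Path spaces\<close>

text \<open>Continuity into a generated topology need only be tested on the subbasis, here the sets
  of paths sending a compact \<open>K\<close> into an open \<open>U\<close>.\<close>

lemma continuous_map_into_path_space:
  assumes top: "\<And>y. y \<in> topspace Y \<Longrightarrow> f y \<in> topspace (path_space X)"
    and "\<And>K U. \<lbrakk>compact K; K \<subseteq> {0..1}; openin X U\<rbrakk> \<Longrightarrow> openin Y {y \<in> topspace Y. f y ` K \<subseteq> U}"
  shows "continuous_map Y (path_space X) f"
proof -
  define S where "S = {{f \<in> extensional (topspace (top_of_set {0..1})).
    continuous_map (top_of_set {0..1}) X f \<and> f ` K \<subseteq> U} | K U.
    compactin (top_of_set {0..1::real}) K \<and> openin X U}"
  have S: "path_space X = topology_generated_by S"
    by (simp add: S_def path_space_def compact_open_topology_def)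
  have "continuous_map Y (topology_generated_by S) f"
  proof (rule continuous_on_generated_topo)
    fix V assume "V \<in> S"
    then obtain K U where K: "compact K" "K \<subseteq> {0..1}" and U: "openin X U"
      and V: "V = {f \<in> topspace (path_space X). f ` K \<subseteq> U}"
      by (auto simp: S_def compactin_subtopology topspace_path_space pathin_def)
    have "f -` V \<inter> topspace Y = {y \<in> topspace Y. f y ` K \<subseteq> U}"
      using top V by auto
    then show "openin Y (f -` V \<inter> topspace Y)"
      using assms(2)[OF K U] by simp
  next
    show "f ` topspace Y \<subseteq> \<Union> S"
      using top unfolding S topology_generated_by_topspace by blast
  qed
  then show ?thesis
    by (simp add: S)
qed

lemma restrict_in_path_space:
  assumes "pathin X \<gamma>"
  shows "restrict \<gamma> {0..1} \<in> topspace (path_space X)"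
proof -
  have "continuous_map (top_of_set {0..1}) X (restrict \<gamma> {0..1})"
    using assms unfolding pathin_def by (rule continuous_map_eq) simp
  then show ?thesis
    by (simp add: topspace_path_space pathin_def)
qed

text \<open>The preimage of the subbasic set for \<open>K\<close> and \<open>U\<close> is the
  subbasic set for \<open>K\<close> and the preimage of \<open>U\<close> under \<open>g\<close>.
  Restriction to the unit interval keeps the result extensional.\<close>

lemma continuous_map_path_space_compose:
  assumes g: "continuous_map X Y g"
  shows "continuous_map (path_space X) (path_space Y) (\<lambda>\<gamma>. restrict (g \<circ> \<gamma>) {0..1})"
proof (rule continuous_map_into_path_space)
  fix \<gamma> assume "\<gamma> \<in> topspace (path_space X)"
  then show "restrict (g \<circ> \<gamma>) {0..1} \<in> topspace (path_space Y)"
    using g by (intro restrict_in_path_space) (auto simp: topspace_path_space pathin_compose)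
next
  fix K U assume K: "compact K" "K \<subseteq> {0..1::real}" and U: "openin Y U"
  have "\<gamma> t \<in> topspace X" if "\<gamma> \<in> topspace (path_space X)" "t \<in> K" for \<gamma> t
    using that K(2) by (auto simp: topspace_path_space pathin_def continuous_map_def)
  then have "{\<gamma> \<in> topspace (path_space X). restrict (g \<circ> \<gamma>) {0..1} ` K \<subseteq> U}
      = {\<gamma> \<in> topspace (path_space X). \<gamma> ` K \<subseteq> {x \<in> topspace X. g x \<in> U}}"
    using K(2) by (auto simp: image_subset_iff subset_iff)
  then show "openin (path_space X) {\<gamma> \<in> topspace (path_space X). restrict (g \<circ> \<gamma>) {0..1} ` K \<subseteq> U}"
    using openin_path_space_subbasis[OF K openin_continuous_map_preimage[OF g U]] by simp
qed

text \<open>An open set of \<open>B \<times> F\<close> need not be a box, so the preimage of a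
  subbasic set is shown to be open around each of its points by a tube argument.\<close>

lemma continuous_map_path_space_Pair:
  "continuous_map (prod_topology B (path_space F)) (path_space (prod_topology B F))
     (\<lambda>(b, \<gamma>). \<lambda>t\<in>{0..1}. (b, \<gamma> t))"
proof (rule continuous_map_into_path_space)
  fix z assume "z \<in> topspace (prod_topology B (path_space F))"
  then show "(case z of (b, \<gamma>) \<Rightarrow> \<lambda>t\<in>{0..1}. (b, \<gamma> t)) \<in> topspace (path_space (prod_topology B F))"
    by (cases z) (auto intro!: restrict_in_path_space continuous_map_pairedI
        simp: topspace_path_space pathin_def simp del: restrict_apply)
next
  fix K U assume K: "compact K" "K \<subseteq> {0..1::real}" and U: "openin (prod_topology B F) U"
  let ?W = "{z \<in> topspace (prod_topology B (path_space F)).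
    (case z of (b, \<gamma>) \<Rightarrow> \<lambda>t\<in>{0..1}. (b, \<gamma> t)) ` K \<subseteq> U}"
  show "openin (prod_topology B (path_space F)) ?W"
    unfolding openin_prod_topology_alt[of _ _ ?W]
  proof (intro allI impI)
    fix b \<gamma> assume "(b, \<gamma>) \<in> ?W"
    then have b: "b \<in> topspace B" and \<gamma>: "\<gamma> \<in> topspace (path_space F)"
      and sub: "(\<lambda>t\<in>{0..1}. (b, \<gamma> t)) ` K \<subseteq> U"
      by auto
    have "compactin (top_of_set {0..1}) K"
      using K by (simp add: compactin_subtopology)
    then have "compactin F (\<gamma> ` K)"
      using \<gamma> by (auto simp: topspace_path_space pathin_def intro: image_compactin)
    moreover have "{b} \<times> \<gamma> ` K \<subseteq> U"
      using sub K(2) by (auto simp: image_subset_iff subset_iff)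
    \<comment> \<open>Tube lemma for the compact sets \<open>{b}\<close> and the image of
      \<open>K\<close> under \<open>\<gamma>\<close>. The required neighbourhood is then
      \<open>M\<close> times the set of paths sending \<open>K\<close> into
      \<open>N\<close>.\<close>
    ultimately obtain M N where "openin B M" "openin F N" "{b} \<subseteq> M" "\<gamma> ` K \<subseteq> N" "M \<times> N \<subseteq> U"
      using Wallace_theorem_prod_topology[of B "{b}" F "\<gamma> ` K" U] b U by (auto simp: compactin_sing)
    then show "\<exists>M N. openin B M \<and> openin (path_space F) N \<and> b \<in> M \<and> \<gamma> \<in> N \<and> M \<times> N \<subseteq> ?W"
      using openin_path_space_subbasis[OF K \<open>openin F N\<close>] \<gamma> K(2) openin_subset[OF \<open>openin B M\<close>]
      by (intro exI[of _ M] exI[of _ "{\<gamma> \<in> topspace (path_space F). \<gamma> ` K \<subseteq> N}"])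
         (auto simp: image_subset_iff subset_iff)
  qed
qed

section \<open>The trivial fibration\<close>

lemma Z2_map_snd_fibrewise_path_space:
  "Z2_map (fibrewise_path_space (prod_topology B F) B fst) reverse_path (path_space F) reverse_path
     (\<lambda>\<gamma>. restrict (snd \<circ> \<gamma>) {0..1})"
  using continuous_map_path_space_compose[OF continuous_map_snd, of B F]
  by (auto simp: Z2_map_def fibrewise_path_space_def reverse_path_def fun_eq_iff
      intro: continuous_map_from_subtopology)

text \<open>A vertical path over \<open>b\<close> is \<open>b\<close> together with a path in
  \<open>F\<close>, and reversal changes only the latter.\<close>

lemma Z2_map_Pair_fibrewise_path_space:
  "Z2_map (prod_topology B (path_space F)) (map_prod id reverse_path)
     (fibrewise_path_space (prod_topology B F) B fst) reverse_path
     (\<lambda>(b, \<gamma>). \<lambda>t\<in>{0..1}. (b, \<gamma> t))"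
  using continuous_map_path_space_Pair[of B F]
  by (auto simp: Z2_map_def fibrewise_path_space_def reverse_path_def fun_eq_iff
      continuous_map_in_subtopology)

lemma Z2_map_snd_fibre_square:
  "Z2_map (fibre_square (prod_topology B F) fst) prod.swap (prod_topology F F) prod.swap
     (map_prod snd snd)"
proof -
  have "continuous_map (prod_topology (prod_topology B F) (prod_topology B F)) (prod_topology F F)
      (\<lambda>z. (snd (fst z), snd (snd z)))"
    by (intro continuous_map_pairedI continuous_map_snd
        continuous_map_compose[OF continuous_map_fst continuous_map_snd, unfolded o_def]
        continuous_map_compose[OF continuous_map_snd continuous_map_snd, unfolded o_def])
  then show ?thesis
    by (auto simp: Z2_map_def fibre_square_def map_prod_def case_prod_unfold
        intro: continuous_map_from_subtopology)
qed

text \<open>This map serves twice: as the retraction when passing from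
  \<open>B \<times> (F \<times> F)\<close> to the fibre square, and, after \<open>Pair b\<close>, as
  the inclusion of a slice.\<close>

lemma Z2_map_Pair_fibre_square:
  "Z2_map (prod_topology B (prod_topology F F)) (map_prod id prod.swap)
     (fibre_square (prod_topology B F) fst) prod.swap (\<lambda>(b, x, y). ((b, x), (b, y)))"
proof -
  have "continuous_map (prod_topology B (prod_topology F F))
      (prod_topology (prod_topology B F) (prod_topology B F))
      (\<lambda>z. ((fst z, fst (snd z)), (fst z, snd (snd z))))"
    by (intro continuous_map_pairedI continuous_map_fst
        continuous_map_compose[OF continuous_map_snd continuous_map_fst, unfolded o_def]
        continuous_map_compose[OF continuous_map_snd continuous_map_snd, unfolded o_def])
  then show ?thesis
    by (auto simp: Z2_map_def fibre_square_def case_prod_unfold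
        intro: continuous_map_into_subtopology)
qed

text \<open>The inverse of the map in \<open>Z2_map_Pair_fibre_square\<close>: on the fibre square
  both base coordinates agree, so keeping the first loses nothing.\<close>

lemma Z2_map_fibre_square_assoc:
  "Z2_map (fibre_square (prod_topology B F) fst) prod.swap
     (prod_topology B (prod_topology F F)) (map_prod id prod.swap)
     (\<lambda>z. (fst (fst z), map_prod snd snd z))"
proof -
  have "continuous_map (fibre_square (prod_topology B F) fst) B (\<lambda>z. fst (fst z))"
    unfolding fibre_square_def
    by (intro continuous_map_from_subtopology
        continuous_map_compose[OF continuous_map_fst continuous_map_fst, unfolded o_def])
  then show ?thesis
    using Z2_map_snd_fibre_square[of B F]
    by (auto simp: Z2_map_def continuous_map_paired fibre_square_def)
qed

lemma Z2_map_const_Pair: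
  assumes "b \<in> topspace B"
  shows "Z2_map X \<sigma> (prod_topology B X) (map_prod id \<sigma>) (Pair b)"
  using assms by (auto simp: Z2_map_def continuous_map_paired)

theorem proposition4p5:
  fixes B :: "'b topology" and F :: "'f topology"
  assumes "topspace B \<noteq> {}"
  shows "symm_param_TC (prod_topology B F) B fst = symm_TC F"
proof -
  let ?P = "fibrewise_path_space (prod_topology B F) B fst"
  let ?S = "fibre_square (prod_topology B F) fst"
  have "secat_Z2_le ?P reverse_path ?S prod.swap endpoints k \<longleftrightarrow>
      secat_Z2_le (path_space F) reverse_path (prod_topology F F) prod.swap endpoints k" for k
  proof
    \<comment> \<open>The slice over \<open>b\<close> embeds \<open>F \<times> F\<close>. For empty
      \<open>B\<close> the fibre square is empty and the left side is 0 whatever \<open>F\<close>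
      is.\<close>
    obtain b where b: "b \<in> topspace B"
      using assms by blast
    show "secat_Z2_le (path_space F) reverse_path (prod_topology F F) prod.swap endpoints k"
      if "secat_Z2_le ?P reverse_path ?S prod.swap endpoints k"
    proof (rule secat_Z2_le_retract[OF Z2_space_prod_swap _ Z2_map_snd_fibre_square _
          Z2_map_snd_fibrewise_path_space _ that])
      show "Z2_map (prod_topology F F) prod.swap ?S prod.swap
          ((\<lambda>(b, x, y). ((b, x), (b, y))) \<circ> Pair b)"
        by (rule Z2_map_compose[OF Z2_map_const_Pair[OF b] Z2_map_Pair_fibre_square])
    qed (auto simp: endpoints_def)
  next
    assume "secat_Z2_le (path_space F) reverse_path (prod_topology F F) prod.swap endpoints k"
    then have "secat_Z2_le (prod_topology B (path_space F)) (map_prod id reverse_path)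
        (prod_topology B (prod_topology F F)) (map_prod id prod.swap) (map_prod id endpoints) k"
      by (rule secat_Z2_le_prod_id)
    \<comment> \<open>The bound on the product is transported along the homeomorphism with the fibre
      square, a retract with mutually inverse \<open>i\<close> and \<open>r\<close>;
      \<open>rotated -1\<close> puts the premise for the chained bound first.\<close>
    then show "secat_Z2_le ?P reverse_path ?S prod.swap endpoints k"
      by (rule secat_Z2_le_retract[OF Z2_space_fibre_square Z2_map_fibre_square_assoc
            Z2_map_Pair_fibre_square _ Z2_map_Pair_fibrewise_path_space, rotated -1])
         (auto simp: endpoints_def fibre_square_def)
  qed
  then show ?thesis
    by (simp add: symm_param_TC_def symm_TC_def secat_Z2_def)
qed

end
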